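(* Let $(\mathcal{G},c)$ be a crystallograph on nodes $\{1,\dots,n\}$, let $J$ be the set of red components of $\mathcal{G}$, with $I_j$ the set of nodes of the component $j\in J$, and let $J'$ be the set of bipartite components of $\mathcal{G}$, where the component $j\in J'$ has set of nodes $I'_j=I'_{j,1}\sqcup I'_{j,2}$ (with a fixed order of the two parts). Then there is a vector space isomorphism $\mathbb{C}^{|J|}\oplus\mathbb{C}^{|J'|}\simeq \mathrm{Ker}(\Phi^{\mathcal{G},c})=\bigcap_{\alpha\in\Phi^{\mathcal{G},c}}\mathrm{Ker}(\alpha)\subseteq V=\mathbb{C}^n$, given on the canonical bases $(\overline{e}_j)_{j\in J}$ of $\mathbb{C}^{|J|}$ and $(\overline{e}'_j)_{j\in J'}$ of $\mathbb{C}^{|J'|}$ by $$\overline{e}_j\longmapsto \sum_{i\in I_j}e_i \quad (j\in J),\qquad \overline{e}'_j\longmapsto\sum_{i\in I'_{j,1}}e_i-\sum_{i\in I'_{j,2}}e_i\quad (j\in J').$$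
   Context: Let $V=\mathbb{C}^n$ with canonical basis $(e_1,\dots,e_n)$ and dual basis $\alpha_i=e_i^\vee\in V^\vee$; put $\alpha^\pm_{ij}=\alpha_i\pm\alpha_j$. A bichromatic graph $(\mathcal{G},c)$ on nodes $\{1,\dots,n\}$ has unoriented straight edges $\{i,j\}$ ($i\ne j$) and loop edges $\{k\}$, each coloured red or green, such that two distinct edges with the same underlying node set have different colours. Here $\Phi^{\mathcal{G},c}\subseteq V^\vee$ consists of $\pm\alpha^-_{ij}$ for each red straight edge $\{i,j\}$, $\pm\alpha^+_{ij}$ for each green straight edge $\{i,j\}$, $\pm\alpha_k$ for each red loop edge at $k$, and $\pm2\alpha_k$ for each green loop edge at $k$. (If there are no edges, the kernel is $V$.) A bichromatic graph is a crystallograph if: (1) for any three distinct nodes $i,j,k$, if there are straight edges $\{i,j\}$ and $\{j,k\}$ then there is a straight edge $\{i,k\}$ which is red if the first two have the same colour, and green if they have different colours; (2) if a node $i$ is incident to a loop edge and to a straight edge $\{i,j\}$, then the graph contains both the red and the green straight edge $\{i,j\}$, and a loop edge at $j$ of the same colour as the one at $i$. A red component is a connected component which has no loops and no green edges and in which every two distinct nodes are joined by a red edge; this includes isolated nodes without loops. A bipartite component is a connected component without loops whose node set is a disjoint union of two nonempty parts, whose red edges are exactly all pairs of distinct nodes within the same part, and whose green edges are exactly all pairs of nodes in different parts. *)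

theory Defs
  imports "HOL-Analysis.Cartesian_Space" "HOL-Analysis.Product_Vector" "HOL-Library.Function_Algebras"
begin

section \<open>Bichromatic graphs\<close>

datatype colour = Red | Green

text \<open>Multigraphs whose set of nodes is the whole type \<open>'n\<close>. An edge \<open>e\<close> with
  \<open>ends G e = {i, j}\<close>, \<open>i \<noteq> j\<close>, is a straight edge, and one with \<open>ends G e = {k}\<close> is a loop.\<close>

record ('n, 'e) multigraph =
  edges :: "'e set"
  ends :: "'e \<Rightarrow> 'n set"

definition bichromatic_graph :: "('n, 'e) multigraph \<Rightarrow> ('e \<Rightarrow> colour) \<Rightarrow> bool" where
  "bichromatic_graph G c \<longleftrightarrow>
     (\<forall>e \<in> edges G. card (ends G e) = 1 \<or> card (ends G e) = 2) \<and>
     (\<forall>e \<in> edges G. \<forall>f \<in> edges G. e \<noteq> f \<and> ends G e = ends G f \<longrightarrow> c e \<noteq> c f)"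

definition has_edge :: "('n, 'e) multigraph \<Rightarrow> ('e \<Rightarrow> colour) \<Rightarrow> 'n set \<Rightarrow> colour \<Rightarrow> bool" where
  "has_edge G c X col \<longleftrightarrow> (\<exists>e \<in> edges G. ends G e = X \<and> c e = col)"

definition crystallograph :: "('n, 'e) multigraph \<Rightarrow> ('e \<Rightarrow> colour) \<Rightarrow> bool" where
  "crystallograph G c \<longleftrightarrow> bichromatic_graph G c \<and>
     (\<forall>i j k col col'. distinct [i, j, k] \<and> has_edge G c {i, j} col \<and> has_edge G c {j, k} col' \<longrightarrow>
        has_edge G c {i, k} (if col = col' then Red else Green)) \<and>
     (\<forall>i j col col'. i \<noteq> j \<and> has_edge G c {i} col \<and> has_edge G c {i, j} col' \<longrightarrow>
        has_edge G c {i, j} Red \<and> has_edge G c {i, j} Green \<and> has_edge G c {j} col)"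

section \<open>Components\<close>

definition adjacency :: "('n, 'e) multigraph \<Rightarrow> ('n \<times> 'n) set" where
  "adjacency G = {(i, j). i \<noteq> j \<and> (\<exists>e \<in> edges G. ends G e = {i, j})}"

text \<open>Connected components are represented by their sets of nodes.\<close>

definition components :: "('n, 'e) multigraph \<Rightarrow> 'n set set" where
  "components G = UNIV // (adjacency G)\<^sup>*"

definition loopless_on :: "('n, 'e) multigraph \<Rightarrow> 'n set \<Rightarrow> bool" where
  "loopless_on G C \<longleftrightarrow> \<not> (\<exists>e \<in> edges G. \<exists>k \<in> C. ends G e = {k})"

definition red_components :: "('n, 'e) multigraph \<Rightarrow> ('e \<Rightarrow> colour) \<Rightarrow> 'n set set" where
  "red_components G c = {C \<in> components G. loopless_on G C \<and>
     \<not> (\<exists>e \<in> edges G. ends G e \<subseteq> C \<and> c e = Green) \<and>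
     (\<forall>i \<in> C. \<forall>j \<in> C. i \<noteq> j \<longrightarrow> has_edge G c {i, j} Red)}"

definition bipartition ::
  "('n, 'e) multigraph \<Rightarrow> ('e \<Rightarrow> colour) \<Rightarrow> 'n set \<Rightarrow> 'n set \<Rightarrow> 'n set \<Rightarrow> bool" where
  "bipartition G c C A B \<longleftrightarrow> A \<noteq> {} \<and> B \<noteq> {} \<and> A \<inter> B = {} \<and> A \<union> B = C \<and>
     (\<forall>i \<in> C. \<forall>j \<in> C. i \<noteq> j \<longrightarrow>
        (has_edge G c {i, j} Red \<longleftrightarrow> (i \<in> A \<and> j \<in> A) \<or> (i \<in> B \<and> j \<in> B)) \<and>
        (has_edge G c {i, j} Green \<longleftrightarrow> (i \<in> A \<and> j \<in> B) \<or> (i \<in> B \<and> j \<in> A)))"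

definition bipartite_components :: "('n, 'e) multigraph \<Rightarrow> ('e \<Rightarrow> colour) \<Rightarrow> 'n set set" where
  "bipartite_components G c =
     {C \<in> components G. loopless_on G C \<and> (\<exists>A B. bipartition G c C A B)}"

section \<open>The kernel\<close>

definition dual_basis :: "'n \<Rightarrow> complex ^ 'n \<Rightarrow> complex" where
  "dual_basis i = (\<lambda>v. v $ i)"

text \<open>Sums, differences and signs of linear forms are the pointwise operations on functions.
  The two signs of \<open>\<alpha>\<^sub>i - \<alpha>\<^sub>j\<close> both occur because \<open>i\<close> and \<open>j\<close> may be exchanged.\<close>

definition root_set ::
  "('n, 'e) multigraph \<Rightarrow> ('e \<Rightarrow> colour) \<Rightarrow> (complex ^ 'n \<Rightarrow> complex) set" where
  "root_set G c =
     {s. \<exists>i j. i \<noteq> j \<and> has_edge G c {i, j} Red \<and>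
        (s = dual_basis i - dual_basis j \<or> s = - (dual_basis i - dual_basis j))} \<union>
     {s. \<exists>i j. i \<noteq> j \<and> has_edge G c {i, j} Green \<and>
        (s = dual_basis i + dual_basis j \<or> s = - (dual_basis i + dual_basis j))} \<union>
     {s. \<exists>k. has_edge G c {k} Red \<and> (s = dual_basis k \<or> s = - dual_basis k)} \<union>
     {s. \<exists>k. has_edge G c {k} Green \<and>
        (s = (\<lambda>v. 2 * dual_basis k v) \<or> s = (\<lambda>v. - 2 * dual_basis k v))}"

definition common_kernel :: "(complex ^ 'n \<Rightarrow> complex) set \<Rightarrow> (complex ^ 'n) set" where
  "common_kernel F = (\<Inter>s \<in> F. {v. s v = 0})"

section \<open>Coordinate spaces and isomorphisms\<close>

text \<open>The coordinate space with basis indexed by \<open>J\<close>: functions on \<open>J\<close>, extended by zero.\<close>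

definition coord_space :: "'j set \<Rightarrow> ('j \<Rightarrow> complex) set" where
  "coord_space J = {x. \<forall>j. j \<notin> J \<longrightarrow> x j = 0}"

definition unit_fun :: "'j \<Rightarrow> 'j \<Rightarrow> complex" where
  "unit_fun j = (\<lambda>k. if k = j then 1 else 0)"

definition pair_scale ::
  "complex \<Rightarrow> ('j \<Rightarrow> complex) \<times> ('k \<Rightarrow> complex) \<Rightarrow> ('j \<Rightarrow> complex) \<times> ('k \<Rightarrow> complex)" where
  "pair_scale a p = (\<lambda>j. a * fst p j, \<lambda>k. a * snd p k)"

definition linear_iso_on ::
  "('a::field \<Rightarrow> 'b::ab_group_add \<Rightarrow> 'b) \<Rightarrow> 'b set \<Rightarrow>
   ('a \<Rightarrow> 'c::ab_group_add \<Rightarrow> 'c) \<Rightarrow> 'c set \<Rightarrow> ('b \<Rightarrow> 'c) \<Rightarrow> bool" where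
  "linear_iso_on s1 A s2 B f \<longleftrightarrow>
     vector_space s1 \<and> module.subspace s1 A \<and> vector_space s2 \<and> module.subspace s2 B \<and>
     (\<forall>x \<in> A. \<forall>y \<in> A. f (x + y) = f x + f y) \<and>
     (\<forall>a. \<forall>x \<in> A. f (s1 a x) = s2 a (f x)) \<and>
     bij_betw f A B"

end

theory Submission
  imports Defs
begin

text \<open>
  A vector \<open>v\<close> lies in the kernel when its coordinates agree along red edges, are opposite
  along green edges and vanish at loops (\<open>mem_kernel_iff\<close>). In a crystallograph two distinct
  nodes of a component are always joined by a straight edge, so the coordinates of \<open>v\<close> on a
  component are determined up to signs by any one of them.

  If \<open>v\<close> does not vanish at some node, then it vanishes nowhere on the component \<open>C\<close> of that
  node. Hence \<open>C\<close> has no loops and no pair of nodes joined in both colours, and the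
  colour of an edge can be read off from \<open>v\<close>: red where the coordinates agree, green where they are
  opposite. The level sets of \<open>v\<close> on \<open>C\<close> therefore show that \<open>C\<close> is a red component (one level
  set) or a bipartite component (two): this is \<open>component_of_support\<close>. So kernel vectors are
  supported on these components, and a kernel vector is constant on a red component, and
  constant up to the sign given by the two parts on a bipartite component. Conversely, every such
  vector is in the kernel. The isomorphism, given in coordinates as \<open>kernel_vector\<close>, spreads
  one free scalar per red or bipartite component with these signs.
\<close>

section \<open>Vectors in the kernel\<close>

lemma mem_kernel_iff:
  "v \<in> common_kernel (root_set G c) \<longleftrightarrow>
     (\<forall>i j. i \<noteq> j \<and> has_edge G c {i, j} Red \<longrightarrow> v $ i = v $ j) \<and>
     (\<forall>i j. i \<noteq> j \<and> has_edge G c {i, j} Green \<longrightarrow> v $ i = - v $ j) \<and>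
     (\<forall>k col. has_edge G c {k} col \<longrightarrow> v $ k = 0)"
  (is "?L \<longleftrightarrow> ?R")
proof
  assume L: ?L
  have root: "s v = 0" if "s \<in> root_set G c" for s
    using L that by (auto simp: common_kernel_def)
  have "v $ i = v $ j" if "i \<noteq> j" "has_edge G c {i, j} Red" for i j
  proof -
    have "dual_basis i - dual_basis j \<in> root_set G c"
      using that unfolding root_set_def by blast
    from root[OF this] show ?thesis by (simp add: dual_basis_def)
  qed
  moreover have "v $ i = - v $ j" if "i \<noteq> j" "has_edge G c {i, j} Green" for i j
  proof -
    have "dual_basis i + dual_basis j \<in> root_set G c"
      using that unfolding root_set_def by blast
    from root[OF this] show ?thesis by (simp add: dual_basis_def eq_neg_iff_add_eq_0)
  qed
  moreover have "v $ k = 0" if "has_edge G c {k} col" for k col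
  proof (cases col)
    case Red
    then have "dual_basis k \<in> root_set G c"
      using that unfolding root_set_def by blast
    from root[OF this] show ?thesis by (simp add: dual_basis_def)
  next
    case Green
    then have "(\<lambda>v. 2 * dual_basis k v) \<in> root_set G c"
      using that unfolding root_set_def by blast
    from root[OF this] show ?thesis by (simp add: dual_basis_def)
  qed
  ultimately show ?R by blast
next
  assume ?R
  then show ?L
    by (auto simp: common_kernel_def root_set_def dual_basis_def)
qed

lemma
  assumes "v \<in> common_kernel (root_set G c)"
  shows kernel_red: "i \<noteq> j \<Longrightarrow> has_edge G c {i, j} Red \<Longrightarrow> v $ i = v $ j"
    and kernel_green: "i \<noteq> j \<Longrightarrow> has_edge G c {i, j} Green \<Longrightarrow> v $ i = - v $ j"
    and kernel_loop: "has_edge G c {k} col \<Longrightarrow> v $ k = 0"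
  by (metis assms mem_kernel_iff)+

lemma subspace_kernel: "vec.subspace (common_kernel (root_set G c))"
  by (auto simp: vec.subspace_def mem_kernel_iff)

section \<open>Components of a crystallograph\<close>

definition component_of :: "('n, 'e) multigraph \<Rightarrow> 'n \<Rightarrow> 'n set" where
  "component_of G i = (adjacency G)\<^sup>* `` {i}"

lemma equiv_adjacency_rtrancl: "equiv UNIV ((adjacency G)\<^sup>*)"
proof -
  have "sym (adjacency G)"
    by (auto simp: sym_def adjacency_def insert_commute)
  then show ?thesis
    by (intro equivI refl_rtrancl sym_rtrancl trans_rtrancl) auto
qed

lemma component_of_self: "i \<in> component_of G i"
  by (simp add: component_of_def)

lemma component_of_in_components: "component_of G i \<in> components G"
  by (simp add: component_of_def components_def quotientI)

lemma component_of_eq_iff: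
  assumes "C \<in> components G"
  shows "component_of G i = C \<longleftrightarrow> i \<in> C"
proof
  assume "i \<in> C"
  obtain j where j: "C = (adjacency G)\<^sup>* `` {j}"
    using assms by (auto simp: components_def elim: quotientE)
  then have "(j, i) \<in> (adjacency G)\<^sup>*"
    using \<open>i \<in> C\<close> by (simp add: j)
  from equiv_class_eq[OF equiv_adjacency_rtrancl this] show "component_of G i = C"
    by (simp only: component_of_def j)
qed (use component_of_self[of i G] in simp)

lemma components_nonempty: "C \<in> components G \<Longrightarrow> C \<noteq> {}"
  using in_quotient_imp_non_empty[OF equiv_adjacency_rtrancl]
  unfolding components_def by blast

lemma adjacency_iff: "(i, j) \<in> adjacency G \<longleftrightarrow> i \<noteq> j \<and> (\<exists>col. has_edge G c {i, j} col)"
  by (auto simp: adjacency_def has_edge_def)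

lemma component_of_edge:
  assumes "i \<noteq> j" "has_edge G c {i, j} col"
  shows "component_of G j = component_of G i"
proof -
  have "(i, j) \<in> adjacency G"
    using assms by (auto simp: adjacency_iff[where c = c])
  then have "j \<in> component_of G i"
    by (auto simp: component_of_def)
  then show ?thesis
    by (simp add: component_of_eq_iff[OF component_of_in_components])
qed

text \<open>The first axiom of a crystallograph shortens any path of straight edges to a single edge.\<close>

lemma crystallograph_component_complete:
  assumes "crystallograph G c" "C \<in> components G" "i \<in> C" "j \<in> C" "i \<noteq> j"
  shows "\<exists>col. has_edge G c {i, j} col"
proof -
  have "j \<in> component_of G i"
    using assms component_of_eq_iff by metis
  then have "(i, j) \<in> (adjacency G)\<^sup>*"
    by (simp add: component_of_def)
  then have "i = j \<or> (i, j) \<in> adjacency G"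
  proof (induction rule: rtrancl_induct)
    case (step k l)
    show ?case
    proof (cases "i = k \<or> i = l")
      case False
      obtain a b where "has_edge G c {i, k} a" "has_edge G c {k, l} b"
        using step False by (auto simp: adjacency_iff[where c = c])
      moreover have "distinct [i, k, l]"
        using step False by (auto simp: adjacency_def)
      ultimately have "has_edge G c {i, l} (if a = b then Red else Green)"
        using assms(1) unfolding crystallograph_def by blast
      then show ?thesis
        using False adjacency_iff by metis
    qed (use step in auto)
  qed simp
  then show ?thesis
    using assms(5) by (simp add: adjacency_iff[where c = c])
qed

lemma loopless_on_no_loop:
  assumes "loopless_on G C" "k \<in> C"
  shows "\<not> has_edge G c {k} col"
  using assms unfolding loopless_on_def has_edge_def by blast

lemma red_component_no_green:
  assumes "C \<in> red_components G c" "i \<in> C" "j \<in> C"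
  shows "\<not> has_edge G c {i, j} Green"
proof
  assume "has_edge G c {i, j} Green"
  then obtain e where "e \<in> edges G" "ends G e = {i, j}" "c e = Green"
    unfolding has_edge_def by blast
  moreover have "{i, j} \<subseteq> C"
    using assms by simp
  ultimately show False
    using assms(1) unfolding red_components_def by auto
qed

lemma
  assumes "bipartition G c C A B"
  shows bipartition_nonempty: "A \<noteq> {}" "B \<noteq> {}"
    and bipartition_disjoint: "A \<inter> B = {}"
    and bipartition_union: "A \<union> B = C"
  using assms by (simp_all only: bipartition_def simp_thms)

lemma
  assumes "bipartition G c C A B" "i \<in> C" "j \<in> C" "i \<noteq> j"
  shows bipartition_red_iff:
      "has_edge G c {i, j} Red \<longleftrightarrow> (i \<in> A \<and> j \<in> A) \<or> (i \<in> B \<and> j \<in> B)"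
    and bipartition_green_iff:
      "has_edge G c {i, j} Green \<longleftrightarrow> (i \<in> A \<and> j \<in> B) \<or> (i \<in> B \<and> j \<in> A)"
  using assms by (simp_all add: bipartition_def)

lemma
  assumes AB: "bipartition G c C A B"
  shows bipartition_red: "i \<in> A \<Longrightarrow> j \<in> A \<Longrightarrow> i \<noteq> j \<Longrightarrow> has_edge G c {i, j} Red"
    and bipartition_green: "i \<in> A \<Longrightarrow> j \<in> B \<Longrightarrow> has_edge G c {i, j} Green"
proof -
  have sub: "A \<subseteq> C" "B \<subseteq> C" and disj: "A \<inter> B = {}"
    using bipartition_union[OF AB] bipartition_disjoint[OF AB] by auto
  show "has_edge G c {i, j} Red" if "i \<in> A" "j \<in> A" "i \<noteq> j"
    using bipartition_red_iff[OF AB _ _ that(3)] sub that by blast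
  show "has_edge G c {i, j} Green" if "i \<in> A" "j \<in> B"
  proof -
    have "i \<noteq> j"
      using disj that by blast
    from bipartition_green_iff[OF AB _ _ this] show ?thesis
      using sub that by blast
  qed
qed

lemma red_not_bipartite:
  assumes "C \<in> red_components G c"
  shows "C \<notin> bipartite_components G c"
proof
  assume "C \<in> bipartite_components G c"
  then obtain A B where AB: "bipartition G c C A B"
    unfolding bipartite_components_def by blast
  obtain i j where ij: "i \<in> A" "j \<in> B"
    using bipartition_nonempty[OF AB] by blast
  then have "i \<in> C" "j \<in> C"
    using bipartition_union[OF AB] by auto
  then show False
    using bipartition_green[OF AB ij] red_component_no_green[OF assms] by simp
qed

section \<open>Kernel vectors on a component\<close>

lemma kernel_on_red_component:
  assumes "v \<in> common_kernel (root_set G c)" "C \<in> red_components G c" "i \<in> C" "j \<in> C"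
  shows "v $ i = v $ j"
proof (cases "i = j")
  case False
  then have "has_edge G c {i, j} Red"
    using assms unfolding red_components_def by blast
  with False show ?thesis
    by (rule kernel_red[OF assms(1)])
qed simp

lemma kernel_on_part:
  assumes "v \<in> common_kernel (root_set G c)" "bipartition G c C A B" "i \<in> A" "j \<in> A"
  shows "v $ i = v $ j"
proof (cases "i = j")
  case False
  then have "has_edge G c {i, j} Red"
    by (rule bipartition_red[OF assms(2-4)])
  with False show ?thesis
    by (rule kernel_red[OF assms(1)])
qed simp

lemma kernel_across_parts:
  assumes "v \<in> common_kernel (root_set G c)" "bipartition G c C A B" "i \<in> A" "j \<in> B"
  shows "v $ j = - v $ i"
proof -
  have "i \<noteq> j"
    using assms bipartition_disjoint[OF assms(2)] by blast
  then have "v $ i = - v $ j"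
    by (rule kernel_green[OF assms(1) _ bipartition_green[OF assms(2-4)]])
  then show ?thesis by simp
qed

text \<open>
  A nonzero coordinate \<open>v $ i\<close> forces \<open>v\<close> to take only the two distinct values \<open>v $ i\<close> and
  \<open>- v $ i\<close> on the component, and these values reveal the colour of every edge; their level sets
  are the parts.
\<close>

lemma component_of_support:
  fixes G :: "('n::finite, 'e) multigraph"
  assumes G: "crystallograph G c" and v: "v \<in> common_kernel (root_set G c)"
    and nz: "v $ i \<noteq> 0"
  shows "component_of G i \<in> red_components G c \<union> bipartite_components G c"
proof -
  define C where "C = component_of G i"
  have C: "C \<in> components G" "i \<in> C"
    by (simp_all add: C_def component_of_in_components component_of_self)
  note red = kernel_red[OF v] and green = kernel_green[OF v] and loop = kernel_loop[OF v]
  have edge: "has_edge G c {j, k} Red \<or> has_edge G c {j, k} Green"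
    if "j \<in> C" "k \<in> C" "j \<noteq> k" for j k
    using crystallograph_component_complete[OF G C(1) that] by (metis colour.exhaust)
  have vals: "v $ j = v $ i \<or> v $ j = - v $ i" if "j \<in> C" for j
    using edge[OF that C(2)] red[of j i] green[of j i] by (cases "j = i") auto
  have nz': "v $ j \<noteq> 0" if "j \<in> C" for j
    using vals[OF that] nz by auto
  have red_iff: "has_edge G c {j, k} Red \<longleftrightarrow> v $ j = v $ k"
    and green_iff: "has_edge G c {j, k} Green \<longleftrightarrow> v $ j = - v $ k"
    if "j \<in> C" "k \<in> C" "j \<noteq> k" for j k
  proof -
    have "v $ k \<noteq> - v $ k"
      using nz'[OF that(2)] by simp
    then show "has_edge G c {j, k} Red \<longleftrightarrow> v $ j = v $ k"
      and "has_edge G c {j, k} Green \<longleftrightarrow> v $ j = - v $ k"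
      using edge[OF that] red[OF that(3)] green[OF that(3)] by metis+
  qed
  have loopless: "loopless_on G C"
    unfolding loopless_on_def
  proof (intro notI, elim bexE)
    fix e k assume "e \<in> edges G" "k \<in> C" "ends G e = {k}"
    then have "has_edge G c {k} (c e)"
      unfolding has_edge_def by blast
    then show False
      using loop nz'[OF \<open>k \<in> C\<close>] by simp
  qed
  define A where "A = {j \<in> C. v $ j = v $ i}"
  define B where "B = {j \<in> C. v $ j = - v $ i}"
  show ?thesis
  proof (cases "B = {}")
    case True
    then have const: "v $ j = v $ i" if "j \<in> C" for j
      using vals[OF that] that by (auto simp: B_def)
    have "c e \<noteq> Green" if e: "e \<in> edges G" "ends G e \<subseteq> C" for e
    proof
      assume ce: "c e = Green"
      have "card (ends G e) = 1 \<or> card (ends G e) = 2"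
        using G e(1) by (auto simp: crystallograph_def bichromatic_graph_def)
      then show False
      proof
        assume "card (ends G e) = 1"
        then obtain k where "ends G e = {k}" by (rule card_1_singletonE)
        then show False
          using loopless e by (auto simp: loopless_on_def)
      next
        assume "card (ends G e) = 2"
        then obtain j k where jk: "ends G e = {j, k}" "j \<noteq> k"
          by (meson card_2_iff)
        then have "v $ j = - v $ k"
          using green[OF jk(2)] ce e(1) unfolding has_edge_def by blast
        then show False
          using const jk(1) e(2) nz by simp
      qed
    qed
    moreover have "has_edge G c {j, k} Red" if "j \<in> C" "k \<in> C" "j \<noteq> k" for j k
      using red_iff[OF that] const[OF that(1)] const[OF that(2)] by simp
    ultimately have "C \<in> red_components G c"
      using C loopless unfolding red_components_def by blast
    then show ?thesis by (simp add: C_def)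
  next
    case False
    have "bipartition G c C A B"
      unfolding bipartition_def
    proof (intro conjI ballI impI)
      show "A \<noteq> {}" using C(2) by (auto simp: A_def)
      show "B \<noteq> {}" by fact
      show "A \<inter> B = {}" using nz by (auto simp: A_def B_def)
      show "A \<union> B = C" using vals by (auto simp: A_def B_def)
    next
      fix j k assume jk: "j \<in> C" "k \<in> C" "j \<noteq> k"
      show "has_edge G c {j, k} Red \<longleftrightarrow> j \<in> A \<and> k \<in> A \<or> j \<in> B \<and> k \<in> B"
        using red_iff[OF jk] vals[OF jk(1)] jk by (auto simp: A_def B_def)
      show "has_edge G c {j, k} Green \<longleftrightarrow> j \<in> A \<and> k \<in> B \<or> j \<in> B \<and> k \<in> A"
        using green_iff[OF jk] vals[OF jk(1)] vals[OF jk(2)] nz jk by (auto simp: A_def B_def)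
    qed
    then show ?thesis
      using C(1) loopless unfolding bipartite_components_def C_def by blast
  qed
qed

section \<open>The isomorphism\<close>

text \<open>
  The two summands never compete: the map is applied to pairs in which the first function vanishes
  off the red components and the second off the bipartite ones, where \<open>P\<close> selects the first part.
  Dispensing with a case distinction on the kind of component makes additivity and homogeneity
  hold for all arguments.
\<close>

definition kernel_vector ::
  "('n::finite, 'e) multigraph \<Rightarrow> ('n set \<Rightarrow> 'n set) \<Rightarrow>
   ('n set \<Rightarrow> complex) \<times> ('n set \<Rightarrow> complex) \<Rightarrow> complex ^ 'n" where
  "kernel_vector G P p =
     (\<chi> i. fst p (component_of G i) +
       (if i \<in> P (component_of G i) then 1 else - 1) * snd p (component_of G i))"

lemma kernel_vector_nth:
  assumes "C \<in> components G" "i \<in> C"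
  shows "kernel_vector G P p $ i = fst p C + (if i \<in> P C then 1 else - 1) * snd p C"
  using component_of_eq_iff[OF assms(1), of i] assms(2) by (simp add: kernel_vector_def)

lemma kernel_vector_add: "kernel_vector G P (p + q) = kernel_vector G P p + kernel_vector G P q"
  by (simp add: kernel_vector_def vec_eq_iff algebra_simps)

lemma kernel_vector_scale: "kernel_vector G P (pair_scale a p) = a *s kernel_vector G P p"
  by (simp add: kernel_vector_def pair_scale_def vec_eq_iff algebra_simps)

lemma sum_axis_nth: "(\<Sum>j\<in>C. axis j 1 :: 'a::semiring_1 ^ 'n::finite) $ i = (if i \<in> C then 1 else 0)"
  by (simp add: axis_def)

lemma kernel_vector_unit_red:
  assumes "C \<in> red_components G c"
  shows "kernel_vector G P (unit_fun C, 0) = (\<Sum>i\<in>C. axis i 1)"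
proof -
  have C: "C \<in> components G"
    using assms by (simp add: red_components_def)
  show ?thesis
    by (simp add: vec_eq_iff sum_axis_nth kernel_vector_def unit_fun_def component_of_eq_iff[OF C]
        del: sum_component)
qed

lemma kernel_vector_unit_bipartite:
  assumes C: "C \<in> components G" and P: "bipartition G c C (P1 C) (P2 C)"
  shows "kernel_vector G P1 (0, unit_fun C) = (\<Sum>i\<in>P1 C. axis i 1) - (\<Sum>i\<in>P2 C. axis i 1)"
proof -
  have parts: "P1 C \<union> P2 C = C" "P1 C \<inter> P2 C = {}"
    using bipartition_union[OF P] bipartition_disjoint[OF P] by auto
  have "kernel_vector G P1 (0, unit_fun C) $ i =
      (if i \<in> P1 C then 1 else 0) - (if i \<in> P2 C then 1 else 0)" for i
  proof (cases "i \<in> C")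
    case True
    with parts show ?thesis
      by (auto simp: kernel_vector_nth[OF C] unit_fun_def)
  next
    case False
    with parts show ?thesis
      by (auto simp: kernel_vector_def unit_fun_def component_of_eq_iff[OF C])
  qed
  then show ?thesis
    by (simp add: vec_eq_iff sum_axis_nth del: sum_component)
qed

text \<open>
  An edge stays inside one component. If that component is bipartite, a red edge preserves the sign
  and a green edge reverses it; red components contain no green edge, and a component with a loop
  is of neither kind, so its coordinates are zero.
\<close>

lemma kernel_vector_in_kernel:
  assumes P: "\<And>C. C \<in> bipartite_components G c \<Longrightarrow> bipartition G c C (P1 C) (P2 C)"
    and x: "x \<in> coord_space (red_components G c)"
    and y: "y \<in> coord_space (bipartite_components G c)"
  shows "kernel_vector G P1 (x, y) \<in> common_kernel (root_set G c)"
  unfolding mem_kernel_iff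
proof (intro conjI allI impI; (elim conjE)?)
  fix i j assume ij: "i \<noteq> j" "has_edge G c {i, j} Red"
  define C where "C = component_of G i"
  have C: "C \<in> components G" "i \<in> C" "j \<in> C"
    using component_of_in_components component_of_self component_of_self[of j G]
    by (simp_all add: C_def component_of_edge[OF ij])
  have "i \<in> P1 C \<longleftrightarrow> j \<in> P1 C" if "C \<in> bipartite_components G c"
    using bipartition_red_iff[OF P[OF that] C(2,3) ij(1)] ij(2) bipartition_disjoint[OF P[OF that]]
    by blast
  then show "kernel_vector G P1 (x, y) $ i = kernel_vector G P1 (x, y) $ j"
    using C y by (auto simp: kernel_vector_nth coord_space_def)
next
  fix i j assume ij: "i \<noteq> j" "has_edge G c {i, j} Green"
  define C where "C = component_of G i"
  have C: "C \<in> components G" "i \<in> C" "j \<in> C"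
    using component_of_in_components component_of_self component_of_self[of j G]
    by (simp_all add: C_def component_of_edge[OF ij])
  have "C \<notin> red_components G c"
    using red_component_no_green C ij by metis
  moreover have "i \<in> P1 C \<longleftrightarrow> j \<notin> P1 C" if "C \<in> bipartite_components G c"
    using bipartition_green_iff[OF P[OF that] C(2,3) ij(1)] ij(2) bipartition_disjoint[OF P[OF that]]
    by blast
  ultimately show "kernel_vector G P1 (x, y) $ i = - kernel_vector G P1 (x, y) $ j"
    using C x y by (auto simp: kernel_vector_nth coord_space_def)
next
  fix k col assume k: "has_edge G c {k} col"
  have "\<not> loopless_on G (component_of G k)"
    using loopless_on_no_loop[OF _ component_of_self[of k G]] k by blast
  then have "component_of G k \<notin> red_components G c"
    "component_of G k \<notin> bipartite_components G c"
    by (simp_all add: red_components_def bipartite_components_def)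
  then show "kernel_vector G P1 (x, y) $ k = 0"
    using x y by (simp add: kernel_vector_def coord_space_def)
qed

text \<open>
  The scalars can be recovered: that of a red component is the value at any of its nodes, that of a
  bipartite component the value at any node of its first part.
\<close>

lemma inj_on_kernel_vector:
  assumes P: "\<And>C. C \<in> bipartite_components G c \<Longrightarrow> bipartition G c C (P1 C) (P2 C)"
  shows "inj_on (kernel_vector G P1)
    (coord_space (red_components G c) \<times> coord_space (bipartite_components G c))"
proof (rule inj_onI, clarify)
  fix x y x' y'
  assume mem: "x \<in> coord_space (red_components G c)" "y \<in> coord_space (bipartite_components G c)"
      "x' \<in> coord_space (red_components G c)" "y' \<in> coord_space (bipartite_components G c)"
    and eq: "kernel_vector G P1 (x, y) = kernel_vector G P1 (x', y')"
  have "x C = x' C" for C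
  proof (cases "C \<in> red_components G c")
    case True
    then have C: "C \<in> components G"
      by (simp add: red_components_def)
    then obtain i where "i \<in> C"
      using components_nonempty by blast
    then show ?thesis
      using arg_cong[OF eq, of "\<lambda>v. v $ i"] red_not_bipartite[OF True] mem
      by (simp add: kernel_vector_nth[OF C] coord_space_def)
  qed (use mem in \<open>simp add: coord_space_def\<close>)
  moreover have "y C = y' C" for C
  proof (cases "C \<in> bipartite_components G c")
    case True
    then have C: "C \<in> components G"
      by (simp add: bipartite_components_def)
    obtain i where "i \<in> C" "i \<in> P1 C"
      using bipartition_nonempty(1)[OF P[OF True]] bipartition_union[OF P[OF True]] by blast
    moreover have "C \<notin> red_components G c"
      using red_not_bipartite True by blast
    ultimately show ?thesis
      using arg_cong[OF eq, of "\<lambda>v. v $ i"] mem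
      by (simp add: kernel_vector_nth[OF C] coord_space_def)
  qed (use mem in \<open>simp add: coord_space_def\<close>)
  ultimately show "x = x' \<and> y = y'" by blast
qed

text \<open>
  The scalars are read off from \<open>v\<close> as for injectivity. Components of neither kind cause no
  obstruction, since \<open>component_of_support\<close> says that \<open>v\<close> vanishes there.
\<close>

lemma kernel_vector_onto_kernel:
  assumes G: "crystallograph G c"
    and P: "\<And>C. C \<in> bipartite_components G c \<Longrightarrow> bipartition G c C (P1 C) (P2 C)"
    and v: "v \<in> common_kernel (root_set G c)"
  shows "v \<in> kernel_vector G P1 `
    (coord_space (red_components G c) \<times> coord_space (bipartite_components G c))"
proof -
  define x where "x C = (if C \<in> red_components G c then v $ (SOME i. i \<in> C) else 0)" for C
  define y where "y C = (if C \<in> bipartite_components G c then v $ (SOME i. i \<in> P1 C) else 0)" for C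
  have "kernel_vector G P1 (x, y) $ i = v $ i" for i
  proof -
    define C where "C = component_of G i"
    have C: "C \<in> components G" "i \<in> C"
      by (simp_all add: C_def component_of_in_components component_of_self)
    consider "C \<in> red_components G c" | "C \<in> bipartite_components G c"
      | "C \<notin> red_components G c" "C \<notin> bipartite_components G c"
      by blast
    then show ?thesis
    proof cases
      case 1
      have "(SOME i. i \<in> C) \<in> C"
        using C(2) by (rule someI)
      then have "x C = v $ i"
        using kernel_on_red_component[OF v 1 _ C(2)] 1 by (simp add: x_def)
      moreover have "y C = 0"
        using red_not_bipartite[OF 1] by (simp add: y_def)
      ultimately show ?thesis
        by (simp add: kernel_vector_nth[OF C])
    next
      case 2
      note bip = P[OF 2]
      have r: "(SOME i. i \<in> P1 C) \<in> P1 C"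
        using bipartition_nonempty(1)[OF bip] by (simp add: some_in_eq)
      have "x C = 0"
        using red_not_bipartite 2 by (auto simp: x_def)
      moreover have "y C = v $ i" if "i \<in> P1 C"
        using kernel_on_part[OF v bip r that] 2 by (simp add: y_def)
      moreover have "y C = - v $ i" if "i \<notin> P1 C"
      proof -
        have "i \<in> P2 C"
          using bipartition_union[OF bip] C(2) that by blast
        from kernel_across_parts[OF v bip r this] show ?thesis
          using 2 by (simp add: y_def)
      qed
      ultimately show ?thesis
        by (simp add: kernel_vector_nth[OF C])
    next
      case 3
      then have "v $ i = 0"
        using component_of_support[OF G v] by (auto simp: C_def)
      then show ?thesis
        using 3 by (simp add: kernel_vector_nth[OF C] x_def y_def)
    qed
  qed
  then have "v = kernel_vector G P1 (x, y)"
    by (simp add: vec_eq_iff)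
  moreover have "x \<in> coord_space (red_components G c)" "y \<in> coord_space (bipartite_components G c)"
    by (simp_all add: coord_space_def x_def y_def)
  ultimately show ?thesis by blast
qed

lemma vector_space_pair_scale: "vector_space pair_scale"
  by unfold_locales (simp_all add: pair_scale_def prod_eq_iff fun_eq_iff algebra_simps)

lemma subspace_coord_spaces: "module.subspace pair_scale (coord_space J \<times> coord_space K)"
proof -
  interpret vector_space pair_scale
    by (rule vector_space_pair_scale)
  show ?thesis
    by (auto simp: subspace_def coord_space_def pair_scale_def zero_prod_def)
qed

theorem proposition5p1p1:
  fixes G :: "('n::finite, 'e) multigraph"
    and c :: "'e \<Rightarrow> colour"
    and P1 P2 :: "'n set \<Rightarrow> 'n set"
  assumes "crystallograph G c"
    and "\<And>C. C \<in> bipartite_components G c \<Longrightarrow> bipartition G c C (P1 C) (P2 C)"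
  shows "\<exists>f :: ('n set \<Rightarrow> complex) \<times> ('n set \<Rightarrow> complex) \<Rightarrow> complex ^ 'n.
           linear_iso_on
             pair_scale (coord_space (red_components G c) \<times> coord_space (bipartite_components G c))
             (*s) (common_kernel (root_set G c)) f \<and>
           (\<forall>C \<in> red_components G c. f (unit_fun C, 0) = (\<Sum>i\<in>C. axis i 1)) \<and>
           (\<forall>C \<in> bipartite_components G c.
              f (0, unit_fun C) = (\<Sum>i\<in>P1 C. axis i 1) - (\<Sum>i\<in>P2 C. axis i 1))"
proof (intro exI[of _ "kernel_vector G P1"] conjI ballI)
  have "bij_betw (kernel_vector G P1)
      (coord_space (red_components G c) \<times> coord_space (bipartite_components G c))
      (common_kernel (root_set G c))"
    using inj_on_kernel_vector[OF assms(2)] kernel_vector_in_kernel[OF assms(2)]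
      kernel_vector_onto_kernel[OF assms]
    unfolding bij_betw_def by auto
  then show "linear_iso_on
      pair_scale (coord_space (red_components G c) \<times> coord_space (bipartite_components G c))
      (*s) (common_kernel (root_set G c)) (kernel_vector G P1)"
    by (simp add: linear_iso_on_def vector_space_pair_scale subspace_coord_spaces
        vec.vector_space_axioms subspace_kernel kernel_vector_add kernel_vector_scale)
next
  fix C assume "C \<in> red_components G c"
  then show "kernel_vector G P1 (unit_fun C, 0) = (\<Sum>i\<in>C. axis i 1)"
    by (rule kernel_vector_unit_red)
next
  fix C assume C: "C \<in> bipartite_components G c"
  then have "C \<in> components G"
    by (simp add: bipartite_components_def)
  from this assms(2)[OF C] show "kernel_vector G P1 (0, unit_fun C) = (\<Sum>i\<in>P1 C. axis i 1) - (\<Sum>i\<in>P2 C. axis i 1)"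
    by (rule kernel_vector_unit_bipartite)
qed

end
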